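(* Let $V$ be a valuation domain with algebraically closed quotient field $K$, and let $W_1,W_2$ be two extensions of $V$ to $K(X)$. If either $\mathcal L_1(W_1)=\mathcal L_1(W_2)\neq\emptyset$ or $\mathcal L_2(W_1)=\mathcal L_2(W_2)\neq\emptyset$, then $W_1=W_2$.
   Context: $v$ is the valuation of $V$ and $\Gamma_v$ its value group. An extension of $V$ to $K(X)$ is a valuation domain $W$ of $K(X)$ with $W\cap K=V$; its valuation $w$ is chosen to extend $v$, so $\Gamma_v\subseteq\Gamma_w$. For such $W$ define $\mathcal L_1(W)=\{\alpha\in K\mid w(X-\alpha)\notin\Gamma_v\}$ and $\mathcal L_2(W)=\{\alpha\in K\mid w(X-\alpha)\in\Gamma_v,\ \text{and } w(X-\alpha+c)=w(X-\alpha)\text{ for every } c\in K\text{ with }v(c)=w(X-\alpha)\}$. *)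

theory Defs
  imports "HOL-Computational_Algebra.Computational_Algebra"
begin

text \<open>
  Membership of \<open>x\<close> or \<open>1/x\<close> for every \<open>x\<close> of the ambient field forces that field to be the
  quotient field of \<open>A\<close>; the trivial case \<open>A = UNIV\<close> is allowed.
\<close>

definition valuation_domain :: "'f::field set \<Rightarrow> bool" where
  "valuation_domain A \<longleftrightarrow>
     1 \<in> A \<and> (\<forall>x\<in>A. \<forall>y\<in>A. x - y \<in> A \<and> x * y \<in> A) \<and> (\<forall>x. x \<noteq> 0 \<longrightarrow> x \<in> A \<or> inverse x \<in> A)"

definition unit_group :: "'f::field set \<Rightarrow> 'f set" where
  "unit_group A = {u. u \<noteq> 0 \<and> u \<in> A \<and> inverse u \<in> A}"

text \<open>
  The valuation of a valuation domain \<open>A\<close> of the field \<open>F\<close> is taken to be the canonical one,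
  \<open>x \<mapsto> x A\<^sup>*\<close>, with value group \<open>F\<^sup>* / A\<^sup>*\<close> ordered by \<open>x A\<^sup>* \<le> y A\<^sup>* \<longleftrightarrow> y / x \<in> A\<close>; the coset
  \<open>{0}\<close> of \<open>0\<close> plays the role of \<open>\<infinity>\<close> and does not belong to the value group. The order is not
  needed below. By \<open>val_eq_iff\<close>, any other valuation with valuation domain \<open>A\<close> takes equal
  values at exactly the same pairs of nonzero elements.
\<close>

definition val :: "'f::field set \<Rightarrow> 'f \<Rightarrow> 'f set" where
  "val A x = (\<lambda>u. u * x) ` unit_group A"

definition value_group :: "'f::field set \<Rightarrow> 'f set set" where
  "value_group A = val A ` (- {0})"

lemma val_eq_iff_div:
  assumes "valuation_domain A" "x \<noteq> 0" "y \<noteq> 0"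
  shows "val A x = val A y \<longleftrightarrow> y / x \<in> unit_group A"
proof
  have one: "1 \<in> unit_group A"
    using assms(1) by (auto simp: unit_group_def valuation_domain_def)
  have mult: "u * u' \<in> unit_group A" if "u \<in> unit_group A" "u' \<in> unit_group A" for u u'
    using assms(1) that by (auto simp: unit_group_def valuation_domain_def)
  have inv: "inverse u \<in> unit_group A" if "u \<in> unit_group A" for u
    using that by (auto simp: unit_group_def)
  have sub: "val A b \<subseteq> val A a" if ab: "a \<noteq> 0" "b / a \<in> unit_group A" for a b
  proof
    fix z assume "z \<in> val A b"
    then obtain u where u: "u \<in> unit_group A" "z = u * b" by (auto simp: val_def)
    have "z = (u * (b / a)) * a" using ab u by simp
    then show "z \<in> val A a" unfolding val_def using mult[OF u(1) ab(2)] by blast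
  qed
  {
    assume "val A x = val A y"
    moreover have "y \<in> val A y" using one by (force simp: val_def)
    ultimately obtain u where "u \<in> unit_group A" "y = u * x" by (auto simp: val_def)
    then show "y / x \<in> unit_group A" using assms(2) by simp
  }
  assume *: "y / x \<in> unit_group A"
  then have "x / y \<in> unit_group A" using inv[OF *] by simp
  then show "val A x = val A y" using sub * assms(2,3) by blast
qed

lemma val_eq_iff:
  fixes f :: "'f::field \<Rightarrow> 'g::linordered_ab_group_add"
  assumes A: "valuation_domain A"
    and mult: "\<And>x y. x \<noteq> 0 \<Longrightarrow> y \<noteq> 0 \<Longrightarrow> f (x * y) = f x + f y"
    and ring: "A = {x. x = 0 \<or> 0 \<le> f x}"
    and x: "x \<noteq> 0" and y: "y \<noteq> 0"
  shows "val A x = val A y \<longleftrightarrow> f x = f y"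
proof -
  have f1: "f 1 = 0" using mult[of 1 1] by simp
  have finv: "f (inverse z) = - f z" if "z \<noteq> 0" for z
    using mult[of z "inverse z"] that f1 by (simp add: eq_neg_iff_add_eq_0 add.commute)
  have "f (y / x) = f y - f x"
    using mult[of y "inverse x"] finv[OF x] x y by (simp add: divide_inverse)
  moreover have "y / x \<in> unit_group A \<longleftrightarrow> f (y / x) = 0"
    using finv[of "y / x"] x y by (auto simp: unit_group_def ring)
  ultimately show ?thesis using val_eq_iff_div[OF A x y] by auto
qed

text \<open>\<open>K(X)\<close> is the fraction field of \<open>K[X]\<close>.\<close>

abbreviation ratfun_const :: "'a::field \<Rightarrow> 'a poly fract" where
  "ratfun_const c \<equiv> to_fract [:c:]"

abbreviation ratfun_X :: "'a::field poly fract" where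
  "ratfun_X \<equiv> to_fract [:0, 1:]"

definition extension_to_ratfun :: "'a::field set \<Rightarrow> 'a poly fract set \<Rightarrow> bool" where
  "extension_to_ratfun V W \<longleftrightarrow> valuation_domain W \<and> W \<inter> range ratfun_const = ratfun_const ` V"

text \<open>
  The identification of \<open>\<Gamma>\<^sub>v\<close> with a subgroup of \<open>\<Gamma>\<^sub>w\<close> that makes \<open>w\<close> extend \<open>v\<close>: the coset \<open>c V\<^sup>*\<close>
  is sent to the coset \<open>c W\<^sup>*\<close>, here obtained as the union of the cosets \<open>d W\<^sup>*\<close> over \<open>d \<in> c V\<^sup>*\<close>.
\<close>

definition value_embed :: "'a::field poly fract set \<Rightarrow> 'a set \<Rightarrow> 'a poly fract set" where
  "value_embed W \<gamma> = (\<Union>d\<in>\<gamma>. val W (ratfun_const d))"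

lemma ratfun_const_mult: "ratfun_const (c * d) = ratfun_const c * ratfun_const d"
  by (simp flip: to_fract_mult)

lemma ratfun_const_inverse: "ratfun_const (inverse c) = inverse (ratfun_const c)"
proof (cases "c = 0")
  case False
  then have "ratfun_const c * ratfun_const (inverse c) = 1"
    by (simp flip: to_fract_mult one_pCons)
  then show ?thesis by (metis inverse_unique)
qed simp

lemma ratfun_const_mem_iff:
  assumes "extension_to_ratfun V W"
  shows "ratfun_const c \<in> W \<longleftrightarrow> c \<in> V"
proof -
  have "ratfun_const c \<in> W \<longleftrightarrow> ratfun_const c \<in> ratfun_const ` V"
    using assms unfolding extension_to_ratfun_def by blast
  then show ?thesis by (auto simp: image_iff)
qed

lemma ratfun_const_unit_iff:
  assumes "extension_to_ratfun V W"
  shows "ratfun_const c \<in> unit_group W \<longleftrightarrow> c \<in> unit_group V"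
  by (simp add: unit_group_def ratfun_const_mem_iff[OF assms] flip: ratfun_const_inverse)

lemma value_embed_val:
  assumes V: "valuation_domain V" and W: "extension_to_ratfun V W"
  shows "value_embed W (val V c) = val W (ratfun_const c)"
proof -
  have W': "valuation_domain W" using W by (simp add: extension_to_ratfun_def)
  have one: "1 \<in> unit_group V"
    using V by (auto simp: unit_group_def valuation_domain_def)
  have "val W (ratfun_const (u * c)) = val W (ratfun_const c)" if u: "u \<in> unit_group V" for u
  proof (cases "c = 0")
    case False
    have u0: "u \<noteq> 0" using u by (simp add: unit_group_def)
    have "ratfun_const (u * c) / ratfun_const c = ratfun_const u"
      using False unfolding ratfun_const_mult by simp
    then have "val W (ratfun_const c) = val W (ratfun_const (u * c))"
      using val_eq_iff_div[OF W', of "ratfun_const c" "ratfun_const (u * c)"] False u0 u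
      by (simp add: ratfun_const_unit_iff[OF W])
    then show ?thesis by simp
  qed simp
  then show ?thesis using one unfolding value_embed_def val_def[of V] by auto
qed

lemma value_embed_inj:
  assumes V: "valuation_domain V" and W: "extension_to_ratfun V W"
  shows "inj_on (value_embed W) (value_group V)"
proof (rule inj_onI)
  fix \<gamma> \<delta> assume "\<gamma> \<in> value_group V" "\<delta> \<in> value_group V" and eq: "value_embed W \<gamma> = value_embed W \<delta>"
  then obtain c d where cd: "c \<noteq> 0" "\<gamma> = val V c" "d \<noteq> 0" "\<delta> = val V d"
    by (auto simp: value_group_def)
  have W': "valuation_domain W" using W by (simp add: extension_to_ratfun_def)
  have "val W (ratfun_const c) = val W (ratfun_const d)"
    using eq cd by (simp add: value_embed_val[OF V W])
  then have "ratfun_const d / ratfun_const c \<in> unit_group W"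
    using val_eq_iff_div[OF W', of "ratfun_const c" "ratfun_const d"] cd by simp
  moreover have "ratfun_const d / ratfun_const c = ratfun_const (d / c)"
    unfolding divide_inverse ratfun_const_mult ratfun_const_inverse by simp
  ultimately have "d / c \<in> unit_group V" by (simp add: ratfun_const_unit_iff[OF W])
  then show "\<gamma> = \<delta>" using val_eq_iff_div[OF V] cd by simp
qed

definition L1 :: "'a::field set \<Rightarrow> 'a poly fract set \<Rightarrow> 'a set" where
  "L1 V W = {\<alpha>. val W (ratfun_X - ratfun_const \<alpha>) \<notin> value_embed W ` value_group V}"

definition L2 :: "'a::field set \<Rightarrow> 'a poly fract set \<Rightarrow> 'a set" where
  "L2 V W = {\<alpha>. val W (ratfun_X - ratfun_const \<alpha>) \<in> value_embed W ` value_group V \<and>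
     (\<forall>c. value_embed W (val V c) = val W (ratfun_X - ratfun_const \<alpha>) \<longrightarrow>
        val W (ratfun_X - ratfun_const \<alpha> + ratfun_const c) = val W (ratfun_X - ratfun_const \<alpha>))}"

end

theory Submission
  imports Defs
begin

text \<open>
  As \<open>K\<close> is algebraically closed, every element of \<open>K(X)\<close> is a quotient of products of constants
  and linear polynomials \<open>X - \<beta>\<close>, so \<open>W\<close> is governed by the values \<open>w(X - \<beta>)\<close>. If \<open>\<alpha>\<close> lies in
  \<open>L\<^sub>1(W)\<close> or \<open>L\<^sub>2(W)\<close>, then \<open>w(X - \<beta>)\<close> is the minimum of \<open>\<gamma> = w(X - \<alpha>)\<close> and \<open>v(\<alpha> - \<beta>)\<close>.
  In the first case \<open>L\<^sub>1(W)\<close> is the set of all \<open>\<beta>\<close> with \<open>v(\<alpha> - \<beta>) > \<gamma>\<close>, which determines the cut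
  of \<open>\<gamma>\<close> in the divisible group \<open>\<Gamma>\<^sub>v\<close> and thereby the sign of every \<open>v(c) + n \<gamma>\<close>. In the
  second case \<open>L\<^sub>2(W)\<close> is the set of all \<open>\<beta>\<close> with \<open>v(\<alpha> - \<beta>) \<ge> \<gamma>\<close>, which determines
  \<open>\<gamma> \<in> \<Gamma>\<^sub>v\<close>.
\<close>

section \<open>Valuation domains\<close>

context
  fixes A :: "'f::field set"
  assumes A: "valuation_domain A"
begin

lemma valuation_domain_one: "1 \<in> A"
  using A by (simp add: valuation_domain_def)

lemma valuation_domain_mult: "x \<in> A \<Longrightarrow> y \<in> A \<Longrightarrow> x * y \<in> A"
  using A by (simp add: valuation_domain_def)

lemma valuation_domain_zero: "0 \<in> A"
  using A unfolding valuation_domain_def by (metis diff_self)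

lemma valuation_domain_add: "x \<in> A \<Longrightarrow> y \<in> A \<Longrightarrow> x + y \<in> A"
  using A valuation_domain_zero unfolding valuation_domain_def
  by (metis diff_0 diff_minus_eq_add)

lemma valuation_domain_minus: "x \<in> A \<Longrightarrow> - x \<in> A"
  using A valuation_domain_zero unfolding valuation_domain_def by (metis diff_0)

lemma valuation_domain_total: "x \<in> A \<or> inverse x \<in> A"
  using A valuation_domain_zero unfolding valuation_domain_def by (cases "x = 0") auto

lemma valuation_domain_power: "x \<in> A \<Longrightarrow> x ^ n \<in> A"
  by (induction n) (auto intro: valuation_domain_one valuation_domain_mult)

lemma unit_group_one: "1 \<in> unit_group A"
  by (simp add: unit_group_def valuation_domain_one)

lemma unit_group_minus: "x \<in> unit_group A \<Longrightarrow> - x \<in> unit_group A"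
  by (simp add: unit_group_def valuation_domain_minus)

lemma unit_group_factor:
  assumes "x * y \<in> unit_group A" "x \<in> A" "y \<in> A"
  shows "x \<in> unit_group A"
proof -
  have "x \<noteq> 0" "y \<noteq> 0" using assms by (auto simp: unit_group_def)
  then have "inverse x = y * inverse (x * y)" by simp
  also have "\<dots> \<in> A"
    using assms(1,3) by (intro valuation_domain_mult) (auto simp: unit_group_def)
  finally show ?thesis using \<open>x \<noteq> 0\<close> assms(2) by (simp add: unit_group_def)
qed

text \<open>A valuation domain is closed under roots: if \<open>y\<close> lay outside,
  \<open>inverse y\<close> would lie inside, and a positive power of \<open>y\<close> in
  \<open>A\<close> would make \<open>inverse y\<close> a unit. So the sign of a multiple of a value
  is read off from the value itself.\<close>

lemma valuation_domain_power_int_iff: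
  "x powi n \<in> A \<longleftrightarrow> n = 0 \<or> (if n > 0 then x \<in> A else inverse x \<in> A)"
proof -
  have power: "y \<in> A" if "y ^ Suc k \<in> A" for y k
  proof (cases "y = 0")
    case False
    show ?thesis
    proof (rule ccontr)
      assume "y \<notin> A"
      then have y: "inverse y \<in> A" using valuation_domain_total by blast
      \<comment> \<open>This product is \<open>inverse y ^ Suc k\<close>, whose inverse
        \<open>y ^ Suc k\<close> lies in \<open>A\<close> as well.\<close>
      have "inverse y * inverse y ^ k \<in> unit_group A"
        using False that valuation_domain_power[OF y, of "Suc k"]
        by (simp add: unit_group_def flip: power_inverse)
      then have "inverse y \<in> unit_group A"
        by (rule unit_group_factor) (use y in \<open>auto intro: valuation_domain_power\<close>)
      then show False using \<open>y \<notin> A\<close> by (simp add: unit_group_def)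
    qed
  qed (simp add: valuation_domain_zero)
  have iff: "y ^ k \<in> A \<longleftrightarrow> y \<in> A" if "k > 0" for y k
    using power[of y "k - 1"] valuation_domain_power[of y k] that by auto
  consider "n = 0" | "n > 0" | "n < 0" by linarith
  then show ?thesis
  proof cases
    case 3
    then have "x powi n = inverse x ^ nat (- n)"
      by (simp add: power_int_def)
    then show ?thesis using 3 iff by simp
  qed (use iff in \<open>simp_all add: valuation_domain_one power_int_nonneg_exp\<close>)
qed

section \<open>Values as cosets of units, and the ultrametric law\<close>

lemma val_eq_0_iff: "val A x = val A 0 \<longleftrightarrow> x = 0"
  using unit_group_one by (force simp: val_def unit_group_def)

lemma val_cong_mult:
  assumes "val A x = val A y"
  shows "val A (x * z) = val A (y * z)"
proof -
  have "val A (x * z) = (\<lambda>u. u * z) ` val A x" for x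
    by (auto simp: val_def image_image mult.assoc)
  then show ?thesis using assms by simp
qed

lemma val_mult:
  assumes "val A x = val A x'" "val A y = val A y'"
  shows "val A (x * y) = val A (x' * y')"
  using val_cong_mult[OF assms(1), of y] val_cong_mult[OF assms(2), of x']
  by (simp add: mult.commute)

lemma val_inverse:
  assumes "val A x = val A y"
  shows "val A (inverse x) = val A (inverse y)"
proof (cases "x = 0 \<or> y = 0")
  case False
  then have "val A y = val A x" using assms by simp
  then have "x / y \<in> unit_group A" using False val_eq_iff_div[OF A] by blast
  then show ?thesis
    using False val_eq_iff_div[OF A, of "inverse x" "inverse y"] by (simp add: field_simps)
qed (use assms val_eq_0_iff in metis)

lemma val_minus: "val A (- x) = val A x"
proof (cases "x = 0")
  case False
  then show ?thesis
    using val_eq_iff_div[OF A, of "- x" x] unit_group_minus[OF unit_group_one] by simp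
qed simp

text \<open>Elements of equal value differ by a unit factor, so each coset lies entirely inside or
  entirely outside \<open>A\<close>.\<close>

lemma val_mem:
  assumes "val A x = val A y"
  shows "x \<in> A \<longleftrightarrow> y \<in> A"
proof -
  have sub: "y \<in> A" if x: "x \<in> A" and eq: "val A x = val A y" for x y
  proof -
    have "y \<in> val A y" using unit_group_one by (force simp: val_def)
    then obtain u where "u \<in> unit_group A" "y = u * x"
      using eq unfolding val_def by blast
    then show ?thesis using x by (auto simp: unit_group_def intro: valuation_domain_mult)
  qed
  show ?thesis using sub[OF _ assms] sub[OF _ assms[symmetric]] by blast
qed

text \<open>The first two hypotheses say that \<open>x\<close> has strictly larger value than \<open>y\<close>.\<close>

lemma val_add_eq:
  assumes "x / y \<in> A" "x / y \<notin> unit_group A" "y \<noteq> 0"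
  shows "val A (x + y) = val A y"
proof -
  define m where "m = x / y"
  have m: "m \<in> A" "m \<notin> unit_group A" using assms by (simp_all add: m_def)
  have m1: "1 + m \<in> A" using m valuation_domain_one valuation_domain_add by blast
  \<comment> \<open>One of \<open>m\<close> and \<open>1 + m\<close> divides the other in
    \<open>A\<close>, hence divides their difference \<open>1\<close> and is a unit. This cannot be
    \<open>m\<close>.\<close>
  have "1 + m \<in> unit_group A"
  proof (rule ccontr)
    assume not_unit: "1 + m \<notin> unit_group A"
    then have "m \<noteq> 0" using unit_group_one by auto
    have "1 + m \<noteq> 0"
    proof
      assume "1 + m = 0"
      then have "m = - 1" by (simp add: eq_neg_iff_add_eq_0 add.commute)
      then show False using m unit_group_minus[OF unit_group_one] by simp
    qed
    show False
    proof (cases "(1 + m) / m \<in> A")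
      case True
      have "(1 + m) / m - 1 = inverse m" using \<open>m \<noteq> 0\<close> by (simp add: field_simps)
      then have "inverse m \<in> A" using True A valuation_domain_one
        unfolding valuation_domain_def by metis
      then show False using m \<open>m \<noteq> 0\<close> by (simp add: unit_group_def)
    next
      case False
      then have "m / (1 + m) \<in> A"
        using valuation_domain_total[of "(1 + m) / m"] by (simp add: inverse_eq_divide)
      moreover have "1 - m / (1 + m) = inverse (1 + m)"
        using \<open>1 + m \<noteq> 0\<close> by (simp add: field_simps)
      ultimately have "inverse (1 + m) \<in> A" using A valuation_domain_one
        unfolding valuation_domain_def by metis
      then show False using not_unit m1 \<open>1 + m \<noteq> 0\<close> by (simp add: unit_group_def)
    qed
  qed
  moreover have eq: "(x + y) / y = 1 + m" using assms(3) by (simp add: m_def field_simps)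
  ultimately have "(x + y) / y \<in> unit_group A" by simp
  moreover have "x + y \<noteq> 0" using calculation by (auto simp: unit_group_def)
  ultimately show ?thesis using val_eq_iff_div[OF A, of y "x + y"] assms(3) by simp
qed

text \<open>The cases order the values: in \<open>less\<close>, \<open>x\<close> has the smaller
  one. Each strict case supplies the hypotheses of \<open>val_add_eq\<close>, so that the smaller
  value is the value of the sum.\<close>

lemma val_less_cases:
  assumes "x \<noteq> 0" "y \<noteq> 0"
  obtains (less) "y / x \<in> A" "y / x \<notin> unit_group A" "x / y \<notin> A"
  | (equal) "val A x = val A y" "x / y \<in> A" "y / x \<in> A"
  | (greater) "x / y \<in> A" "x / y \<notin> unit_group A" "y / x \<notin> A"
proof -
  have "inverse (x / y) = y / x" by (simp add: inverse_eq_divide)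
  then show ?thesis
    using that assms valuation_domain_total[of "x / y"] val_eq_iff_div[OF A assms]
    by (auto simp: unit_group_def inverse_eq_divide)
qed

end

section \<open>Extensions to the rational function field\<close>

text \<open>Numerator and denominator split into linear factors, so a property compatible with
  products and inverses only has to be checked on constants and on linear polynomials.\<close>

lemma ratfun_linear_induct [consumes 1, case_names const linear mult inverse]:
  fixes f :: "'a::alg_closed_field poly fract"
  assumes "f \<noteq> 0"
    and const: "\<And>c. c \<noteq> 0 \<Longrightarrow> P (ratfun_const c)"
    and linear: "\<And>\<beta>. P (ratfun_X - ratfun_const \<beta>)"
    and mult: "\<And>g h. P g \<Longrightarrow> P h \<Longrightarrow> P (g * h)"
    and inverse: "\<And>g. P g \<Longrightarrow> P (inverse g)"
  shows "P f"
proof -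
  have X: "to_fract [:- \<beta>, 1:] = ratfun_X - ratfun_const \<beta>" for \<beta> :: 'a
    by (simp flip: to_fract_diff)
  have prod: "P (to_fract (\<Prod>x\<in>#B. [:- x, 1:]))" for B
  proof (induction B)
    case empty
    then show ?case using const[of 1] by (simp add: one_pCons[symmetric])
  next
    case (add \<beta> B)
    then show ?case using mult[OF linear add] by (simp only: image_mset_add_mset prod_mset.add_mset to_fract_mult X)
  qed
  have poly: "P (to_fract p)" if p: "p \<noteq> 0" for p
  proof -
    obtain B where B: "p = smult (lead_coeff p) (\<Prod>x\<in>#B. [:- x, 1:])"
      using alg_closed_imp_factorization[OF p] by blast
    have "to_fract p = ratfun_const (lead_coeff p) * to_fract (\<Prod>x\<in>#B. [:- x, 1:])"
      by (subst B) (simp flip: to_fract_mult)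
    then show ?thesis using mult[OF const prod, of "lead_coeff p" B] p by simp
  qed
  obtain p q where "f = Fract p q" "q \<noteq> 0" by (cases f)
  moreover have "p \<noteq> 0" using calculation assms(1) by (auto simp: eq_fract Zero_fract_def)
  ultimately show ?thesis
    using mult[OF poly inverse[OF poly], of p q]
    by (simp add: Fract_conv_to_fract divide_inverse)
qed

lemma ratfun_X_minus_const_nonzero: "ratfun_X - ratfun_const \<alpha> \<noteq> 0"
  by (simp flip: to_fract_diff)

lemma ratfun_const_divide: "ratfun_const (c / d) = ratfun_const c / ratfun_const d"
  by (simp only: divide_inverse ratfun_const_mult ratfun_const_inverse)

lemma ratfun_const_power: "ratfun_const (c ^ n) = ratfun_const c ^ n"
  by (induction n) (simp_all add: ratfun_const_mult one_pCons[symmetric])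

lemma ratfun_X_shift:
  "ratfun_X - ratfun_const \<beta> = (ratfun_X - ratfun_const \<alpha>) + ratfun_const (\<alpha> - \<beta>)"
  by (simp flip: to_fract_diff to_fract_add)

text \<open>This is the source of the divisibility of the value group. For negative
  \<open>n\<close>, the inverse of a root of order \<open>- n\<close> serves.\<close>

lemma alg_closed_power_int_root:
  fixes c :: "'a::alg_closed_field"
  assumes "n \<noteq> 0" "c \<noteq> 0"
  obtains d where "d \<noteq> 0" "d powi n = c"
proof (cases "n > 0")
  case True
  then obtain d where "d ^ nat n = c" using nth_root_exists[of "nat n" c] by auto
  then show ?thesis using that[of d] True assms by (auto simp: power_int_def)
next
  case False
  then obtain d where d: "d ^ nat (- n) = c" using nth_root_exists[of "nat (- n)" c] assms by auto
  then have "d \<noteq> 0" using assms False by auto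
  then show ?thesis using that[of "inverse d"] False d by (auto simp: power_int_def)
qed

lemma ratfun_const_power_int: "ratfun_const (c powi n) = ratfun_const c powi n"
  by (simp add: power_int_def ratfun_const_power ratfun_const_inverse)

text \<open>By multiplicativity, every nonzero element gets the value of one monomial in
  \<open>t\<close>, the same for \<open>W1\<close> and \<open>W2\<close>. It remains to compare the
  monomials, and divisibility reduces these to exponents 1 and -1. The uses take \<open>t\<close> to
  be a linear polynomial for \<open>L1\<close> and \<open>1\<close> for \<open>L2\<close>.\<close>

lemma extension_to_ratfun_eqI:
  fixes V :: "'a::alg_closed_field set"
  assumes W1: "extension_to_ratfun V W1" and W2: "extension_to_ratfun V W2"
    and t: "\<And>d. d \<noteq> 0 \<Longrightarrow> ratfun_const d * t \<in> W1 \<longleftrightarrow> ratfun_const d * t \<in> W2"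
    and t_inv: "\<And>d. d \<noteq> 0 \<Longrightarrow>
      inverse (ratfun_const d * t) \<in> W1 \<longleftrightarrow> inverse (ratfun_const d * t) \<in> W2"
    and t0: "t \<noteq> 0"
    and linear: "\<And>\<beta>. \<exists>c n. c \<noteq> 0 \<and> (\<forall>W\<in>{W1, W2}.
      val W (ratfun_X - ratfun_const \<beta>) = val W (ratfun_const c * t powi n))"
  shows "W1 = W2"
proof -
  have VW: "valuation_domain W" if "W \<in> {W1, W2}" for W
    using that W1 W2 by (auto simp: extension_to_ratfun_def)
  have normal_form: "\<exists>c n. c \<noteq> 0 \<and> (\<forall>W\<in>{W1, W2}. val W f = val W (ratfun_const c * t powi n))"
    if "f \<noteq> 0" for f
    using that
  proof (induction f rule: ratfun_linear_induct)
    case (const c)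
    then show ?case by (intro exI[of _ c] exI[of _ 0]) simp
  next
    case (linear \<beta>)
    show ?case by (fact assms(6))
  next
    case (mult g h)
    then obtain c n d m where cd: "c \<noteq> 0" "d \<noteq> 0"
      and g: "\<And>W. W \<in> {W1, W2} \<Longrightarrow> val W g = val W (ratfun_const c * t powi n)"
      and h: "\<And>W. W \<in> {W1, W2} \<Longrightarrow> val W h = val W (ratfun_const d * t powi m)"
      by metis
    have "val W (g * h) = val W (ratfun_const (c * d) * t powi (n + m))" if "W \<in> {W1, W2}" for W
      using val_mult[OF VW[OF that] g[OF that] h[OF that]] t0
      by (simp only: ratfun_const_mult) (simp add: power_int_add mult_ac)
    then show ?case using cd by (metis mult_eq_0_iff)
  next
    case (inverse g)
    then obtain c n where c: "c \<noteq> 0"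
      and g: "\<And>W. W \<in> {W1, W2} \<Longrightarrow> val W g = val W (ratfun_const c * t powi n)"
      by metis
    have "val W (inverse g) = val W (ratfun_const (inverse c) * t powi (- n))"
      if "W \<in> {W1, W2}" for W
      using val_inverse[OF VW[OF that] g[OF that]]
      by (simp only: ratfun_const_inverse) (simp add: power_int_minus)
    then show ?case using c by (metis inverse_nonzero_iff_nonzero)
  qed
  have monomial: "ratfun_const c * t powi n \<in> W1 \<longleftrightarrow> ratfun_const c * t powi n \<in> W2"
    if c: "c \<noteq> 0" for c n
  proof (cases "n = 0")
    case True
    then show ?thesis using ratfun_const_mem_iff[OF W1] ratfun_const_mem_iff[OF W2] by simp
  next
    case False
    then obtain d where d: "d \<noteq> 0" "c = d powi n" using alg_closed_power_int_root c by metis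
    \<comment> \<open>With \<open>c = d powi n\<close> the whole monomial is an \<open>n\<close>-th
      power, so the sign of \<open>n\<close> selects whether \<open>ratfun_const d * t\<close> or
      its inverse has to be tested.\<close>
    have eq: "ratfun_const c * t powi n = (ratfun_const d * t) powi n"
      by (simp only: d(2) ratfun_const_power_int power_int_mult_distrib)
    show ?thesis
      unfolding eq using t[OF d(1)] t_inv[OF d(1)]
      by (simp only: valuation_domain_power_int_iff[OF VW] insertI1 insertI2 cong: if_cong)
  qed
  have "f \<in> W1 \<longleftrightarrow> f \<in> W2" for f
  proof (cases "f = 0")
    case True
    then show ?thesis using valuation_domain_zero VW by auto
  next
    case False
    then obtain c n where c: "c \<noteq> 0"
      and f: "\<And>W. W \<in> {W1, W2} \<Longrightarrow> val W f = val W (ratfun_const c * t powi n)"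
      using normal_form by metis
    show ?thesis
      using val_mem[OF VW f] monomial[OF c] by simp
  qed
  then show ?thesis by blast
qed

section \<open>The sets \<open>L1\<close> and \<open>L2\<close>\<close>

context
  fixes V :: "'a::alg_closed_field set" and W :: "'a poly fract set"
  assumes V: "valuation_domain V" and W: "extension_to_ratfun V W"
begin

lemma valuation_domain_extension: "valuation_domain W"
  using W by (simp add: extension_to_ratfun_def)

lemma val_mem_value_group_iff:
  "val W x \<in> value_embed W ` value_group V \<longleftrightarrow> (\<exists>c. c \<noteq> 0 \<and> val W x = val W (ratfun_const c))"
proof -
  have "value_embed W ` value_group V = {val W (ratfun_const c) |c. c \<noteq> 0}"
    by (auto simp: value_group_def image_image value_embed_val[OF V W])
  then show ?thesis by auto
qed

lemma mem_L1_iff: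
  "\<alpha> \<in> L1 V W \<longleftrightarrow> (\<forall>c. c \<noteq> 0 \<longrightarrow> val W (ratfun_X - ratfun_const \<alpha>) \<noteq> val W (ratfun_const c))"
  by (auto simp: L1_def val_mem_value_group_iff)

lemma mem_L2_iff:
  "\<alpha> \<in> L2 V W \<longleftrightarrow>
    (\<exists>c. c \<noteq> 0 \<and> val W (ratfun_X - ratfun_const \<alpha>) = val W (ratfun_const c)) \<and>
    (\<forall>c. val W (ratfun_const c) = val W (ratfun_X - ratfun_const \<alpha>) \<longrightarrow>
      val W (ratfun_X - ratfun_const \<alpha> + ratfun_const c) = val W (ratfun_X - ratfun_const \<alpha>))"
  by (simp add: L2_def val_mem_value_group_iff value_embed_val[OF V W])

text \<open>The two summands of \<open>t + ratfun_const (\<alpha> - \<beta>)\<close> never have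
  equal value, since the value of \<open>t\<close> is not that of a constant; the smaller value
  wins. Hence membership of \<beta> in \<open>L1\<close> tells on which side of the cut the value of
  \<alpha> - \<beta> lies.\<close>

lemma L1_linear_cases:
  assumes \<alpha>: "\<alpha> \<in> L1 V W" and "\<beta> \<noteq> \<alpha>"
  defines "t \<equiv> ratfun_X - ratfun_const \<alpha>"
  obtains (gt) "t / ratfun_const (\<alpha> - \<beta>) \<in> W" "ratfun_const (\<alpha> - \<beta>) / t \<notin> W" "\<beta> \<notin> L1 V W"
    "val W (ratfun_X - ratfun_const \<beta>) = val W (ratfun_const (\<alpha> - \<beta>))"
  | (lt) "t / ratfun_const (\<alpha> - \<beta>) \<notin> W" "ratfun_const (\<alpha> - \<beta>) / t \<in> W" "\<beta> \<in> L1 V W"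
    "val W (ratfun_X - ratfun_const \<beta>) = val W t"
proof -
  note W' = valuation_domain_extension
  have t0: "t \<noteq> 0" by (simp add: t_def ratfun_X_minus_const_nonzero)
  have e0: "\<alpha> - \<beta> \<noteq> 0" "ratfun_const (\<alpha> - \<beta>) \<noteq> 0" using \<open>\<beta> \<noteq> \<alpha>\<close> by auto
  have X: "ratfun_X - ratfun_const \<beta> = t + ratfun_const (\<alpha> - \<beta>)"
    unfolding t_def by (rule ratfun_X_shift)
  have t: "val W t \<noteq> val W (ratfun_const c)" if "c \<noteq> 0" for c
    using \<alpha> that unfolding mem_L1_iff t_def by blast
  show ?thesis
  proof (cases rule: val_less_cases[OF W' t0 e0(2), case_names less equal greater])
    case less
    then have "val W (ratfun_X - ratfun_const \<beta>) = val W t"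
      using val_add_eq[OF W' less(1,2) t0] unfolding X by (simp only: add.commute)
    then show ?thesis using lt less t by (simp add: mem_L1_iff)
  next
    case equal
    then show ?thesis using t e0 by blast
  next
    case greater
    then have "val W (ratfun_X - ratfun_const \<beta>) = val W (ratfun_const (\<alpha> - \<beta>))"
      using val_add_eq[OF W' _ _ e0(2)] X by simp
    then show ?thesis using gt greater e0 unfolding mem_L1_iff by blast
  qed
qed

section \<open>Linear polynomials seen from a point of \<open>L2\<close>, with \<open>c\<close>
  realizing the value \<gamma>\<close>

context
  fixes \<alpha> c :: 'a
  assumes \<alpha>: "\<alpha> \<in> L2 V W" and c0: "c \<noteq> 0"
    and t: "val W (ratfun_X - ratfun_const \<alpha>) = val W (ratfun_const c)"
begin

lemma L2_val_add:
  assumes "val W (ratfun_const d) = val W (ratfun_const c)"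
  shows "val W (ratfun_X - ratfun_const \<alpha> + ratfun_const d) = val W (ratfun_const c)"
  using \<alpha> t assms unfolding mem_L2_iff by metis

text \<open>If \<alpha> - \<beta> has value above \<gamma>, the ultrametric law applies; if its
  value equals \<gamma>, the defining condition of \<open>L2\<close> at \<alpha> keeps the value of
  the sum from rising.\<close>

lemma L2_val_linear_in:
  assumes "(\<alpha> - \<beta>) / c \<in> V"
  shows "val W (ratfun_X - ratfun_const \<beta>) = val W (ratfun_const c)"
proof (cases "\<alpha> = \<beta>")
  case False
  note W' = valuation_domain_extension
  have t0: "ratfun_X - ratfun_const \<alpha> \<noteq> 0" by (rule ratfun_X_minus_const_nonzero)
  have e: "ratfun_const (\<alpha> - \<beta>) / ratfun_const c \<in> W"
    using assms ratfun_const_mem_iff[OF W] by (metis ratfun_const_divide)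
  have e0: "ratfun_const (\<alpha> - \<beta>) \<noteq> 0" using False by auto
  \<comment> \<open>Equality of values lets the linear polynomial replace \<open>c\<close> in the
    denominator; this rules out the case \<open>greater\<close> below.\<close>
  have ratio: "ratfun_const (\<alpha> - \<beta>) / (ratfun_X - ratfun_const \<alpha>) \<in> W"
    using e val_mem[OF W' val_cong_mult[OF W' val_inverse[OF W' t], of "ratfun_const (\<alpha> - \<beta>)"]]
    by (simp add: divide_inverse mult.commute)
  show ?thesis
  proof (cases rule: val_less_cases[OF W' t0 e0, case_names less equal greater])
    case less
    then show ?thesis
      using val_add_eq[OF W' less(1,2) t0] t unfolding ratfun_X_shift[of \<beta> \<alpha>]
      by (simp only: add.commute)
  next
    case equal
    then show ?thesis using L2_val_add[of "\<alpha> - \<beta>"] t unfolding ratfun_X_shift[of \<beta> \<alpha>] by simp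
  qed (use ratio in blast)
qed (use t in simp)

text \<open>Here \<alpha> - \<beta> has value strictly below \<gamma> and dominates the sum.\<close>

lemma L2_val_linear_out:
  assumes "(\<alpha> - \<beta>) / c \<notin> V"
  shows "val W (ratfun_X - ratfun_const \<beta>) = val W (ratfun_const (\<alpha> - \<beta>))"
proof -
  note W' = valuation_domain_extension
  have t0: "ratfun_X - ratfun_const \<alpha> \<noteq> 0" by (rule ratfun_X_minus_const_nonzero)
  have e: "ratfun_const (\<alpha> - \<beta>) / ratfun_const c \<notin> W"
    using assms ratfun_const_mem_iff[OF W] by (metis ratfun_const_divide)
  have "\<alpha> \<noteq> \<beta>" using assms valuation_domain_zero[OF V] by auto
  then have e0: "ratfun_const (\<alpha> - \<beta>) \<noteq> 0" by auto
  have "ratfun_const (\<alpha> - \<beta>) / (ratfun_X - ratfun_const \<alpha>) \<notin> W"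
    using e val_mem[OF W' val_cong_mult[OF W' val_inverse[OF W' t], of "ratfun_const (\<alpha> - \<beta>)"]]
    by (simp add: divide_inverse mult.commute)
  then show ?thesis
    using val_less_cases[OF W' t0 e0] val_add_eq[OF W' _ _ e0] ratfun_X_shift[of \<beta> \<alpha>] by metis
qed

text \<open>\<open>L2\<close> is the closed ball around \<alpha> of radius \<gamma>. Inside, adding
  a constant of value \<gamma> only moves the centre within the ball. Outside, adding \<beta> -
  \<alpha> returns to the linear polynomial at \<alpha>, whose value is larger, so the condition
  fails.\<close>

lemma L2_iff: "\<beta> \<in> L2 V W \<longleftrightarrow> (\<alpha> - \<beta>) / c \<in> V"
proof
  assume \<beta>: "(\<alpha> - \<beta>) / c \<in> V"
  have "val W (ratfun_X - ratfun_const \<beta> + ratfun_const d) = val W (ratfun_const c)"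
    if "val W (ratfun_const d) = val W (ratfun_const c)" for d
  proof -
    note W' = valuation_domain_extension
    have "ratfun_const (d / c) \<in> W"
      using val_mem[OF W' val_cong_mult[OF W' that, of "inverse (ratfun_const c)"]] c0
        valuation_domain_one[OF W']
      unfolding ratfun_const_divide by (simp add: divide_inverse)
    then have "d / c \<in> V" using ratfun_const_mem_iff[OF W] by simp
    then have "(\<alpha> - \<beta>) / c + d / c \<in> V" using \<beta> valuation_domain_add[OF V] by blast
    \<comment> \<open>Adding \<open>d\<close> to the linear polynomial at \<beta> gives the one at
      \<beta> - d, which is still in the ball.\<close>
    then have "(\<alpha> - (\<beta> - d)) / c \<in> V" by (simp add: add_divide_distrib[symmetric] algebra_simps)
    from L2_val_linear_in[OF this] show ?thesis
      using ratfun_X_shift[of "\<beta> - d" \<beta>] by simp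
  qed
  then show "\<beta> \<in> L2 V W"
    unfolding mem_L2_iff L2_val_linear_in[OF \<beta>] using c0 by blast
next
  assume \<beta>: "\<beta> \<in> L2 V W"
  show "(\<alpha> - \<beta>) / c \<in> V"
  proof (rule ccontr)
    note W' = valuation_domain_extension
    assume not: "(\<alpha> - \<beta>) / c \<notin> V"
    note val_\<beta> = L2_val_linear_out[OF not]
    have "val W (ratfun_const (\<beta> - \<alpha>)) = val W (ratfun_X - ratfun_const \<beta>)"
      using val_minus[OF W', of "ratfun_const (\<alpha> - \<beta>)"] val_\<beta> by (simp flip: to_fract_uminus)
    then have "val W (ratfun_X - ratfun_const \<beta> + ratfun_const (\<beta> - \<alpha>))
        = val W (ratfun_X - ratfun_const \<beta>)"
      using \<beta> unfolding mem_L2_iff by blast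
    then have "val W (ratfun_const c) = val W (ratfun_const (\<alpha> - \<beta>))"
      using t val_\<beta> ratfun_X_shift[of \<alpha> \<beta>] by simp
    from val_mem[OF W' val_cong_mult[OF W' this, of "inverse (ratfun_const c)"]]
    have "ratfun_const ((\<alpha> - \<beta>) / c) \<in> W"
      unfolding ratfun_const_divide using c0 valuation_domain_one[OF W']
      by (simp add: divide_inverse)
    then show False using not ratfun_const_mem_iff[OF W] by simp
  qed
qed

end

end

section \<open>Recovering the extension from \<open>L1\<close> or from \<open>L2\<close>\<close>

lemma extension_to_ratfun_eqI_L1:
  fixes V :: "'a::alg_closed_field set"
  assumes V: "valuation_domain V"
    and W1: "extension_to_ratfun V W1" and W2: "extension_to_ratfun V W2"
    and L: "L1 V W1 = L1 V W2" and \<alpha>: "\<alpha> \<in> L1 V W1"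
  shows "W1 = W2"
proof -
  define t where "t = ratfun_X - ratfun_const \<alpha>"
  have t0: "t \<noteq> 0" by (simp add: t_def ratfun_X_minus_const_nonzero)
  have \<alpha>': "\<alpha> \<in> L1 V W2" using \<alpha> L by simp
  \<comment> \<open>Every nonzero \<open>e\<close> is a difference \<alpha> - \<beta> with \<beta> =
    \<alpha> - e, so the common \<open>L1\<close> decides the comparison of \<open>t\<close> with
    \<open>e\<close> identically in both extensions.\<close>
  have cut: "(t / ratfun_const e \<in> W1 \<longleftrightarrow> t / ratfun_const e \<in> W2) \<and>
      (ratfun_const e / t \<in> W1 \<longleftrightarrow> ratfun_const e / t \<in> W2)" if "e \<noteq> 0" for e
  proof -
    have \<beta>: "\<alpha> - e \<noteq> \<alpha>" "\<alpha> - (\<alpha> - e) = e" using that by auto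
    show ?thesis
      using L1_linear_cases[OF V W1 \<alpha> \<beta>(1)] L1_linear_cases[OF V W2 \<alpha>' \<beta>(1)] L
      unfolding \<beta>(2) t_def[symmetric] by metis
  qed
  show ?thesis
  proof (rule extension_to_ratfun_eqI[OF W1 W2, of t])
    fix d :: 'a assume "d \<noteq> 0"
    then have d: "inverse d \<noteq> 0" by simp
    have eq: "ratfun_const d * t = t / ratfun_const (inverse d)"
      "inverse (ratfun_const d * t) = ratfun_const (inverse d) / t"
      unfolding ratfun_const_inverse by (simp_all add: field_simps)
    show "ratfun_const d * t \<in> W1 \<longleftrightarrow> ratfun_const d * t \<in> W2"
      "inverse (ratfun_const d * t) \<in> W1 \<longleftrightarrow> inverse (ratfun_const d * t) \<in> W2"
      unfolding eq using cut[OF d] by simp_all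
  next
    fix \<beta>
    show "\<exists>c n. c \<noteq> 0 \<and> (\<forall>W\<in>{W1, W2}.
      val W (ratfun_X - ratfun_const \<beta>) = val W (ratfun_const c * t powi n))"
    proof (cases "\<beta> = \<alpha>")
      case True
      then show ?thesis
        \<comment> \<open>The same rule instance supplies both witnesses, the constant 1 and the
          exponent 1.\<close>
        by (intro exI[of _ 1]) (simp add: t_def one_pCons[symmetric])
    next
      case False
      show ?thesis
      proof (cases "\<beta> \<in> L1 V W1")
        case True
        have "val W (ratfun_X - ratfun_const \<beta>) = val W t" if "W \<in> {W1, W2}" for W
          using that True L L1_linear_cases[OF V W1 \<alpha> False] L1_linear_cases[OF V W2 \<alpha>' False]
          unfolding t_def by (metis insertE singletonD)
        then show ?thesis by (intro exI[of _ 1]) (simp add: one_pCons[symmetric])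
      next
        case not_mem: False
        have "val W (ratfun_X - ratfun_const \<beta>) = val W (ratfun_const (\<alpha> - \<beta>))"
          if "W \<in> {W1, W2}" for W
          using that not_mem L L1_linear_cases[OF V W1 \<alpha> False] L1_linear_cases[OF V W2 \<alpha>' False]
          by (metis insertE singletonD)
        then show ?thesis
          using False by (intro exI[of _ "\<alpha> - \<beta>"] exI[of _ 0]) simp
      qed
    qed
  qed (fact t0)
qed

lemma extension_to_ratfun_eqI_L2:
  fixes V :: "'a::alg_closed_field set"
  assumes V: "valuation_domain V"
    and W1: "extension_to_ratfun V W1" and W2: "extension_to_ratfun V W2"
    and L: "L2 V W1 = L2 V W2" and \<alpha>: "\<alpha> \<in> L2 V W1"
  shows "W1 = W2"
proof -
  have \<alpha>': "\<alpha> \<in> L2 V W2" using \<alpha> L by simp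
  obtain c where c: "c \<noteq> 0" "val W1 (ratfun_X - ratfun_const \<alpha>) = val W1 (ratfun_const c)"
    using \<alpha> mem_L2_iff[OF V W1] by blast
  obtain d where d: "d \<noteq> 0" "val W2 (ratfun_X - ratfun_const \<alpha>) = val W2 (ratfun_const d)"
    using \<alpha>' mem_L2_iff[OF V W2] by blast
  note iff1 = L2_iff[OF V W1 \<alpha> c] and iff2 = L2_iff[OF V W2 \<alpha>' d]
  have ball_eq: "e / c \<in> V \<longleftrightarrow> e / d \<in> V" for e
    using iff1[of "\<alpha> - e"] iff2[of "\<alpha> - e"] L by simp
  \<comment> \<open>The two balls around \<alpha> coincide; testing them at \<open>c\<close> and at
    \<open>d\<close> shows that their radii are equal.\<close>
  have "c / d \<in> V" "d / c \<in> V"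
    using ball_eq[of c] ball_eq[of d] c d valuation_domain_one[OF V] by simp_all
  then have "c / d \<in> unit_group V" using c d by (simp add: unit_group_def)
  then have "ratfun_const c / ratfun_const d \<in> unit_group W2"
    using ratfun_const_unit_iff[OF W2] by (metis ratfun_const_divide)
  then have d': "val W2 (ratfun_const d) = val W2 (ratfun_const c)"
    using val_eq_iff_div[OF valuation_domain_extension[OF V W2], of "ratfun_const d" "ratfun_const c"] c d
    by simp
  \<comment> \<open>All linear polynomials now have values of constants, so \<open>t = 1\<close>
    suffices and the comparison of monomials takes place in \<open>V\<close>.\<close>
  show ?thesis
  proof (rule extension_to_ratfun_eqI[OF W1 W2, of 1])
    fix e :: 'a
    show "ratfun_const e * 1 \<in> W1 \<longleftrightarrow> ratfun_const e * 1 \<in> W2"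
      "inverse (ratfun_const e * 1) \<in> W1 \<longleftrightarrow> inverse (ratfun_const e * 1) \<in> W2"
      by (simp_all add: ratfun_const_mem_iff[OF W1] ratfun_const_mem_iff[OF W2]
          flip: ratfun_const_inverse)
  next
    fix \<beta>
    show "\<exists>c n. c \<noteq> 0 \<and> (\<forall>W\<in>{W1, W2}.
      val W (ratfun_X - ratfun_const \<beta>) = val W (ratfun_const c * 1 powi n))"
    proof (cases "(\<alpha> - \<beta>) / c \<in> V")
      case True
      then show ?thesis
        using L2_val_linear_in[OF V W1 \<alpha> c True] L2_val_linear_in[OF V W2 \<alpha>' d] ball_eq d' c(1)
        by (intro exI[of _ c]) simp
    next
      case False
      then have "\<alpha> \<noteq> \<beta>" using valuation_domain_zero[OF V] by auto
      then show ?thesis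
        using L2_val_linear_out[OF V W1 \<alpha> c False] L2_val_linear_out[OF V W2 \<alpha>' d] ball_eq False
        by (intro exI[of _ "\<alpha> - \<beta>"]) simp
    qed
  qed simp
qed

theorem proposition4p5:
  fixes V :: "'a::alg_closed_field set" and W1 W2 :: "'a poly fract set"
  assumes "valuation_domain V"
    and "extension_to_ratfun V W1" and "extension_to_ratfun V W2"
    and "(L1 V W1 = L1 V W2 \<and> L1 V W2 \<noteq> {}) \<or> (L2 V W1 = L2 V W2 \<and> L2 V W2 \<noteq> {})"
  shows "W1 = W2"
  using assms extension_to_ratfun_eqI_L1 extension_to_ratfun_eqI_L2 by blast

end
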